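(* Let $r\ge 1$, $m\ge 2$, and let $\mathcal{A}=\{e^{2\pi i j/2^r}:0\le j<2^r\}$ be the set of complex $2^r$-th roots of unity. Consider 2-dimensional subspaces (planes) of $\mathbb{C}^m$ each generated by two vectors from $\mathcal{A}^m$. Then any family of such planes which pairwise intersect only in $\{0\}$ has at most $\frac12|\mathcal{A}|^{m-1}=2^{(m-1)r-1}$ members. *)

theory Defs
  imports "HOL-Analysis.Analysis"
begin

definition roots_2pow :: "nat \<Rightarrow> complex set" where
  "roots_2pow r = {exp (2 * of_real pi * \<i> * of_nat j / 2 ^ r) | j. j < 2 ^ r}"

text \<open>
  The qualified constants \<open>vec.span\<close> and \<open>vec.dim\<close> are the complex-linear ones here;
  the unqualified \<open>span\<close> and \<open>dim\<close> are the real ones.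
\<close>

definition plane_generated_by :: "complex set \<Rightarrow> (complex ^ 'm) set \<Rightarrow> bool" where
  "plane_generated_by A P \<longleftrightarrow>
     vec.dim P = 2 \<and>
     (\<exists>u v. (\<forall>i. u $ i \<in> A) \<and> (\<forall>i. v $ i \<in> A) \<and> P = vec.span {u, v})"

end

theory Submission
  imports Defs
begin

text \<open>
  Fix a coordinate \<open>k\<close>. Each plane of the family contains two non-proportional vectors with
  entries in the group \<open>\<A>\<close>, and dividing each by its \<open>k\<close>-th entry yields two distinct vectors
  over \<open>\<A>\<close> with \<open>k\<close>-th entry \<open>1\<close>. There are only \<open>|\<A>|\<^sup>m\<^sup>-\<^sup>1\<close> such vectors, and planes meeting
  trivially share none of them.
\<close>

lemma roots_2pow_eq: "roots_2pow r = {z. z ^ (2 ^ r) = 1}"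
  using complex_roots_unity[of "2 ^ r"] by (simp add: roots_2pow_def)

lemma card_roots_2pow: "card (roots_2pow r) = 2 ^ r"
  using card_complex_roots_unity[of "2 ^ r"] by (simp add: roots_2pow_eq)

lemma finite_roots_2pow: "finite (roots_2pow r)"
  by (rule card_ge_0_finite) (simp add: card_roots_2pow)

lemma divide_in_roots_2pow:
  "a \<in> roots_2pow r \<Longrightarrow> b \<in> roots_2pow r \<Longrightarrow> a / b \<in> roots_2pow r"
  by (simp add: roots_2pow_eq power_divide)

lemma nonzero_roots_2pow: "a \<in> roots_2pow r \<Longrightarrow> a \<noteq> 0"
  by (auto simp: roots_2pow_eq power_0_left)

text \<open>When \<open>A\<close> is the group of roots of unity, these are canonical
  representatives: every complex line spanned by a vector over \<open>A\<close> contains exactly one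
  of them.\<close>

definition normalized_vectors :: "'a::one set \<Rightarrow> 'm \<Rightarrow> ('a ^ 'm) set" where
  "normalized_vectors A k = {w. w $ k = 1 \<and> (\<forall>i. w $ i \<in> A)}"

lemma normalized_vectors_finite_card_le:
  fixes A :: "'a::one set" and k :: "'m::finite"
  assumes "finite A"
  shows "finite (normalized_vectors A k)"
    and "card (normalized_vectors A k) \<le> card A ^ (CARD('m) - 1)"
proof -
  let ?B = "PiE (UNIV - {k}) (\<lambda>_. A)"
  \<comment> \<open>Only the entries away from \<open>k\<close> are free; \<open>?f\<close> puts the
    forced entry 1 back. Covering the set by the image of \<open>?f\<close> is enough for an upper
    bound.\<close>
  let ?f = "\<lambda>g. \<chi> i. if i = k then 1 else g i"
  have fin: "finite ?B"
    using assms by (intro finite_PiE) auto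
  have sub: "normalized_vectors A k \<subseteq> ?f ` ?B"
  proof
    fix w assume "w \<in> normalized_vectors A k"
    then have "w = ?f (restrict (\<lambda>i. w $ i) (UNIV - {k}))"
      and "restrict (\<lambda>i. w $ i) (UNIV - {k}) \<in> ?B"
      by (auto simp: normalized_vectors_def vec_eq_iff)
    then show "w \<in> ?f ` ?B"
      by (rule image_eqI)
  qed
  show "finite (normalized_vectors A k)"
    using sub fin by (meson finite_imageI finite_subset)
  have "card (normalized_vectors A k) \<le> card ?B"
    using sub fin by (meson card_image_le card_mono finite_imageI order_trans)
  also have "card ?B = card A ^ (CARD('m) - 1)"
    by (simp add: card_PiE card_Diff_singleton)
  finally show "card (normalized_vectors A k) \<le> card A ^ (CARD('m) - 1)" .
qed

lemma two_le_card_plane_Int_normalized: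
  fixes P :: "(complex ^ 'm) set"
  assumes "plane_generated_by (roots_2pow r) P"
  shows "2 \<le> card (P \<inter> normalized_vectors (roots_2pow r) k)"
proof -
  let ?N = "normalized_vectors (roots_2pow r) k"
  obtain u v where u: "\<And>i. u $ i \<in> roots_2pow r" and v: "\<And>i. v $ i \<in> roots_2pow r"
    and P: "P = vec.span {u, v}" and dim: "vec.dim P = 2"
    using assms unfolding plane_generated_by_def by blast
  define u' where "u' = inverse (u $ k) *s u"
  define v' where "v' = inverse (v $ k) *s v"
  have nz: "u $ k \<noteq> 0" "v $ k \<noteq> 0"
    using u v nonzero_roots_2pow by blast+
  have "u' \<in> P" "v' \<in> P"
    unfolding P u'_def v'_def by (auto intro: vec.span_scale vec.span_base)
  moreover have "u' \<in> ?N" "v' \<in> ?N"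
    using nz divide_in_roots_2pow[OF u u] divide_in_roots_2pow[OF v v]
    by (auto simp: normalized_vectors_def u'_def v'_def divide_inverse mult.commute)
  moreover have "u' \<noteq> v'"
  \<comment> \<open>If the two normalizations coincide, both generators are multiples of
    \<open>u'\<close>, so \<open>P\<close> lies in a line, against dimension 2.\<close>
  proof
    assume eq: "u' = v'"
    have "u = (u $ k) *s u'"
      using nz by (simp add: u'_def)
    moreover have "v = (v $ k) *s u'"
      using nz by (simp add: eq v'_def)
    ultimately have "{u, v} \<subseteq> vec.span {u'}"
      by (metis empty_subsetI insert_subset vec.span_base vec.span_scale insertI1)
    then have "P \<subseteq> vec.span {u'}"
      unfolding P by (rule vec.span_minimal) simp
    then have "vec.dim P \<le> card {u'}"
      by (rule vec.dim_le_card) simp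
    with dim show False by simp
  qed
  ultimately have "{u', v'} \<subseteq> P \<inter> ?N" "card {u', v'} = 2"
    by auto
  moreover have "finite (P \<inter> ?N)"
    using normalized_vectors_finite_card_le(1)[OF finite_roots_2pow] by blast
  ultimately show ?thesis
    by (metis card_mono)
qed

text \<open>The traces \<open>P \<inter> N\<close> are pairwise disjoint subsets of \<open>N\<close>
  with at least \<open>c\<close> elements each, so their sizes add up to at most
  \<open>card N\<close>. Since \<open>c\<close> is positive, traces are nonempty, and disjointness
  makes them distinct; thus \<open>F\<close> embeds into the finite set \<open>Pow N\<close>.
  Finiteness has to come first, because \<open>card\<close> of an infinite family is 0 and the bound
  alone would say nothing about it.\<close>

lemma card_mult_le_of_disjoint_Int:
  assumes "finite N" and "0 < c"
    and large: "\<And>P. P \<in> F \<Longrightarrow> c \<le> card (P \<inter> N)"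
    and disj: "\<And>P Q. P \<in> F \<Longrightarrow> Q \<in> F \<Longrightarrow> P \<noteq> Q \<Longrightarrow> P \<inter> Q \<inter> N = {}"
  shows "finite F" and "c * card F \<le> card N"
proof -
  have "inj_on (\<lambda>P. P \<inter> N) F"
  proof (rule inj_onI, rule ccontr)
    fix P Q assume PQ: "P \<in> F" "Q \<in> F" "P \<inter> N = Q \<inter> N" "P \<noteq> Q"
    then have "P \<inter> N = {}" using disj[of P Q] by blast
    with large[OF \<open>P \<in> F\<close>] \<open>0 < c\<close> show False by simp
  qed
  moreover have "(\<lambda>P. P \<inter> N) ` F \<subseteq> Pow N" by blast
  ultimately show fin: "finite F"
    using \<open>finite N\<close> by (meson finite_Pow_iff inj_on_finite)
  have "c * card F = (\<Sum>P\<in>F. c)" by simp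
  also have "\<dots> \<le> (\<Sum>P\<in>F. card (P \<inter> N))"
    by (rule sum_mono) (rule large)
  also have "\<dots> = card (\<Union>P\<in>F. P \<inter> N)"
    by (rule card_UN_disjoint[symmetric]) (use fin \<open>finite N\<close> disj in auto)
  also have "\<dots> \<le> card N"
    by (rule card_mono) (use \<open>finite N\<close> in auto)
  finally show "c * card F \<le> card N" .
qed

theorem theorem4p1:
  fixes r :: nat and F :: "(complex ^ 'm) set set"
  assumes "r \<ge> 1" and "CARD('m) \<ge> 2"
    and "\<And>P. P \<in> F \<Longrightarrow> plane_generated_by (roots_2pow r) P"
    and "\<And>P Q. P \<in> F \<Longrightarrow> Q \<in> F \<Longrightarrow> P \<noteq> Q \<Longrightarrow> P \<inter> Q = {0}"
  shows "finite F \<and>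
    real (card F) \<le> 1 / 2 * real (card (roots_2pow r)) ^ (CARD('m) - 1) \<and>
    1 / 2 * real (card (roots_2pow r)) ^ (CARD('m) - 1) = 2 ^ ((CARD('m) - 1) * r - 1)"
proof -
  fix k :: 'm
  let ?N = "normalized_vectors (roots_2pow r) k"
  note N = normalized_vectors_finite_card_le[OF finite_roots_2pow, of r k]
  \<comment> \<open>The only common point of two planes is 0, whose entry at \<open>k\<close> is not
    1.\<close>
  have disj: "P \<inter> Q \<inter> ?N = {}" if "P \<in> F" "Q \<in> F" "P \<noteq> Q" for P Q
    using assms(4)[OF that] by (auto simp: normalized_vectors_def)
  note count = card_mult_le_of_disjoint_Int[OF N(1) zero_less_numeral
      two_le_card_plane_Int_normalized[OF assms(3)] disj]
  have "2 * card F \<le> card (roots_2pow r) ^ (CARD('m) - 1)"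
    using count(2) N(2) by (rule order_trans)
  then have "2 * real (card F) \<le> real (card (roots_2pow r)) ^ (CARD('m) - 1)"
    by (metis of_nat_le_iff of_nat_mult of_nat_numeral of_nat_power)
  moreover have "1 / 2 * real (card (roots_2pow r)) ^ (CARD('m) - 1)
      = 2 ^ ((CARD('m) - 1) * r - 1)"
  proof -
    \<comment> \<open>Subtraction in the exponent is truncated on naturals; a positive product
      ensures that subtracting 1 really halves the power of 2.\<close>
    have "0 < (CARD('m) - 1) * r" using assms(1,2) by simp
    then obtain d where "(CARD('m) - 1) * r = Suc d"
      using gr0_implies_Suc by blast
    then show ?thesis
      by (simp add: card_roots_2pow mult.commute flip: power_mult)
  qed
  ultimately show ?thesis
    using count(1) by simp
qed

end
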